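(* Let $U\colon[0,1]^2\to[0,1]$ be a uninorm with $U\in\mathcal{UR}$. Then $U\in\mathcal{U}$ if and only if at each point $(x,y)\in[0,1]^2$ the uninorm $U$ is either left-continuous or right-continuous.
   Context: A uninorm is a function $U\colon[0,1]^2\to[0,1]$ which is commutative, associative, non-decreasing (not necessarily strictly) in both variables and has a neutral element $e\in(0,1)$, i.e. $U(e,x)=x$ for all $x\in[0,1]$. For a uninorm $U$ with neutral element $e$, its underlying t-norm and t-conorm are $T_U(x,y)=\frac{1}{e}U(ex,ey)$ and $S_U(x,y)=\frac{U(e+(1-e)x,\,e+(1-e)y)-e}{1-e}$ for $x,y\in[0,1]$. $\mathcal{U}$ denotes the set of all uninorms $U$ such that both $T_U$ and $S_U$ are continuous on $[0,1]^2$. A set-valued function on $[0,1]$ is a mapping $p\colon[0,1]\to\mathcal{P}([0,1])$. It is non-increasing if for all $x_1<x_2$ in $[0,1]$ we have $y_1\ge y_2$ for all $y_1\in p(x_1)$ and all $y_2\in p(x_2)$; symmetric if $y\in p(x)$ if and only if $x\in p(y)$; surjective if for every $y\in[0,1]$ there is an $x\in[0,1]$ with $y\in p(x)$. Its graph is $G(p)=\{(x,y)\in[0,1]^2\mid y\in p(x)\}$. $\mathcal{UR}$ denotes the set of all uninorms $U$ (with neutral element $e$) for which there exists a symmetric, surjective, non-increasing set-valued function $r$ on $[0,1]$ with graph $R=G(r)$ such that $U$, as a function on $[0,1]^2$, is continuous at every point of $[0,1]^2\setminus R$, and $U(x,y)=e$ implies $(x,y)\in R$. $U$ is left-continuous at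 $(x_0,y_0)\in[0,1]^2$ if for every $\varepsilon>0$ there is $\delta>0$ such that $|U(x,y)-U(x_0,y_0)|<\varepsilon$ for all $(x,y)\in[0,1]^2$ with $x\in[x_0-\delta,x_0]$, $y\in[y_0-\delta,y_0]$. Right-continuity at $(x_0,y_0)$ is defined in the same way with $x\in[x_0,x_0+\delta]$, $y\in[y_0,y_0+\delta]$. *)

theory Defs
  imports "HOL-Analysis.Analysis"
begin

text \<open>
  A binary operation on the unit interval is a function \<open>real \<Rightarrow> real \<Rightarrow> real\<close>. Every notion below
  looks at it on the unit square only, so its values elsewhere are irrelevant.
\<close>

abbreviation unit_interval :: "real set" where
  "unit_interval \<equiv> {0..1}"

definition uninorm_with :: "real \<Rightarrow> (real \<Rightarrow> real \<Rightarrow> real) \<Rightarrow> bool" where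
  "uninorm_with e U \<longleftrightarrow>
     (\<forall>x\<in>unit_interval. \<forall>y\<in>unit_interval. U x y \<in> unit_interval) \<and>
     (\<forall>x\<in>unit_interval. \<forall>y\<in>unit_interval. U x y = U y x) \<and>
     (\<forall>x\<in>unit_interval. \<forall>y\<in>unit_interval. \<forall>z\<in>unit_interval. U (U x y) z = U x (U y z)) \<and>
     (\<forall>x\<in>unit_interval. mono_on unit_interval (\<lambda>y. U x y)) \<and>
     (\<forall>y\<in>unit_interval. mono_on unit_interval (\<lambda>x. U x y)) \<and>
     e \<in> {0<..<1} \<and>
     (\<forall>x\<in>unit_interval. U e x = x)"

definition uninorm :: "(real \<Rightarrow> real \<Rightarrow> real) \<Rightarrow> bool" where
  "uninorm U \<longleftrightarrow> (\<exists>e. uninorm_with e U)"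

text \<open>
  The neutral element is determined by \<open>U\<close>, so quantifying it existentially in the classes
  \<open>uninorms_cont\<close> and \<open>uninorms_UR\<close> refers to the neutral element of \<open>U\<close>.
\<close>

lemma uninorm_with_unique: "uninorm_with e U \<Longrightarrow> uninorm_with e' U \<Longrightarrow> e = e'"
  unfolding uninorm_with_def by (metis atLeastAtMost_iff greaterThanLessThan_iff less_imp_le)

definition underlying_tnorm :: "real \<Rightarrow> (real \<Rightarrow> real \<Rightarrow> real) \<Rightarrow> real \<Rightarrow> real \<Rightarrow> real" where
  "underlying_tnorm e U x y = (1 / e) * U (e * x) (e * y)"

definition underlying_tconorm :: "real \<Rightarrow> (real \<Rightarrow> real \<Rightarrow> real) \<Rightarrow> real \<Rightarrow> real \<Rightarrow> real" where
  "underlying_tconorm e U x y = (U (e + (1 - e) * x) (e + (1 - e) * y) - e) / (1 - e)"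

definition uninorms_cont :: "(real \<Rightarrow> real \<Rightarrow> real) set" where
  "uninorms_cont = {U. \<exists>e. uninorm_with e U \<and>
     continuous_on (unit_interval \<times> unit_interval) (\<lambda>(x, y). underlying_tnorm e U x y) \<and>
     continuous_on (unit_interval \<times> unit_interval) (\<lambda>(x, y). underlying_tconorm e U x y)}"

definition set_valued :: "(real \<Rightarrow> real set) \<Rightarrow> bool" where
  "set_valued p \<longleftrightarrow> (\<forall>x\<in>unit_interval. p x \<subseteq> unit_interval)"

definition sv_nonincreasing :: "(real \<Rightarrow> real set) \<Rightarrow> bool" where
  "sv_nonincreasing p \<longleftrightarrow>
     (\<forall>x1\<in>unit_interval. \<forall>x2\<in>unit_interval. x1 < x2 \<longrightarrow> (\<forall>y1\<in>p x1. \<forall>y2\<in>p x2. y1 \<ge> y2))"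

definition sv_symmetric :: "(real \<Rightarrow> real set) \<Rightarrow> bool" where
  "sv_symmetric p \<longleftrightarrow> (\<forall>x\<in>unit_interval. \<forall>y\<in>unit_interval. y \<in> p x \<longleftrightarrow> x \<in> p y)"

definition sv_surjective :: "(real \<Rightarrow> real set) \<Rightarrow> bool" where
  "sv_surjective p \<longleftrightarrow> (\<forall>y\<in>unit_interval. \<exists>x\<in>unit_interval. y \<in> p x)"

definition sv_graph :: "(real \<Rightarrow> real set) \<Rightarrow> (real \<times> real) set" where
  "sv_graph p = {(x, y). x \<in> unit_interval \<and> y \<in> unit_interval \<and> y \<in> p x}"

definition uninorms_UR :: "(real \<Rightarrow> real \<Rightarrow> real) set" where
  "uninorms_UR = {U. \<exists>e. uninorm_with e U \<and>
     (\<exists>r. set_valued r \<and> sv_symmetric r \<and> sv_surjective r \<and> sv_nonincreasing r \<and>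
       (\<forall>z \<in> unit_interval \<times> unit_interval - sv_graph r.
          continuous (at z within unit_interval \<times> unit_interval) (\<lambda>(x, y). U x y)) \<and>
       (\<forall>x\<in>unit_interval. \<forall>y\<in>unit_interval. U x y = e \<longrightarrow> (x, y) \<in> sv_graph r))}"

definition left_continuous_at :: "(real \<Rightarrow> real \<Rightarrow> real) \<Rightarrow> real \<Rightarrow> real \<Rightarrow> bool" where
  "left_continuous_at U x0 y0 \<longleftrightarrow>
     (\<forall>\<epsilon>>0. \<exists>\<delta>>0. \<forall>x\<in>unit_interval. \<forall>y\<in>unit_interval.
        x \<in> {x0 - \<delta>..x0} \<and> y \<in> {y0 - \<delta>..y0} \<longrightarrow> \<bar>U x y - U x0 y0\<bar> < \<epsilon>)"

definition right_continuous_at :: "(real \<Rightarrow> real \<Rightarrow> real) \<Rightarrow> real \<Rightarrow> real \<Rightarrow> bool" where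
  "right_continuous_at U x0 y0 \<longleftrightarrow>
     (\<forall>\<epsilon>>0. \<exists>\<delta>>0. \<forall>x\<in>unit_interval. \<forall>y\<in>unit_interval.
        x \<in> {x0..x0 + \<delta>} \<and> y \<in> {y0..y0 + \<delta>} \<longrightarrow> \<bar>U x y - U x0 y0\<bar> < \<epsilon>)"

end

theory Submission
  imports Defs
begin

text \<open>
  Everything is proved for the lower square \<open>[0,e]\<^sup>2\<close>, on which \<open>U\<close> is a rescaled copy of its
  t-norm; the statements about the t-conorm follow by applying these results to the dual uninorm
  \<open>1 - U (1 - x) (1 - y)\<close>, which exchanges t-norm and t-conorm as well as left- and
  right-continuity.

  \<^emph>\<open>Continuous underlying operations imply one-sided continuity.\<close> If \<open>u = U x y \<le> e\<close>, continuity of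
  the t-norm makes every \<open>c \<in> [0,u)\<close> a value \<open>U u s\<close> with \<open>s \<le> e\<close>. Associativity turns this into
  \<open>c = U (U x s) y\<close>, where \<open>U x s \<le> x\<close>. So \<open>U\<close> takes all values in \<open>[0,u)\<close> to the left
  of the point, and a monotone function that skips no value cannot jump: \<open>U\<close> is
  left-continuous at \<open>(x, y)\<close> (\<open>left_continuous_below_neutral\<close>). Dually, \<open>U x y \<ge> e\<close> gives
  right-continuity, and one of the two cases always applies.

  \<^emph>\<open>One-sided continuity implies continuous underlying operations.\<close> As \<open>(e, e)\<close> lies on the
  decreasing curve \<open>R\<close>, the curve avoids \<open>[0,e)\<^sup>2\<close>, and only the points \<open>(x, e)\<close> and \<open>(e, x)\<close>
  with \<open>x \<le> e\<close> need attention. There \<open>U x e = x\<close> bounds \<open>U\<close> from above, so left-continuity is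
  all that is missing. If \<open>x < e\<close> and \<open>(x, e)\<close> is on \<open>R\<close>, then \<open>R\<close> leaves free the whole
  region \<open>(x, e] \<times> (e, 1]\<close>. On that region \<open>U\<close> is continuous and avoids the value \<open>e\<close>, while
  \<open>U e y = y > e\<close>; hence \<open>U > e\<close> there. This jump above \<open>U x e = x < e\<close> excludes
  right-continuity at \<open>(x, e)\<close>, so \<open>U\<close> is left-continuous (\<open>left_continuous_at_neutral\<close>).
\<close>

section \<open>Elementary properties of uninorms\<close>

context
  fixes e :: real and U :: "real \<Rightarrow> real \<Rightarrow> real"
  assumes U: "uninorm_with e U"
begin

lemma uninorm_neutral_bounds: "0 < e" "e < 1"
  using U unfolding uninorm_with_def by auto

lemma uninorm_range:
  assumes "x \<in> {0..1}" "y \<in> {0..1}"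
  shows "U x y \<in> {0..1}"
  using U assms unfolding uninorm_with_def by blast

lemma uninorm_commute:
  assumes "x \<in> {0..1}" "y \<in> {0..1}"
  shows "U x y = U y x"
  using U assms unfolding uninorm_with_def by blast

lemma uninorm_assoc:
  assumes "x \<in> {0..1}" "y \<in> {0..1}" "z \<in> {0..1}"
  shows "U (U x y) z = U x (U y z)"
  using U assms unfolding uninorm_with_def by blast

lemma uninorm_neutral_left: "x \<in> {0..1} \<Longrightarrow> U e x = x"
  using U unfolding uninorm_with_def by blast

lemma uninorm_neutral_right: "x \<in> {0..1} \<Longrightarrow> U x e = x"
  using uninorm_neutral_left[of x] uninorm_commute[of e x] uninorm_neutral_bounds by simp

lemma uninorm_mono:
  assumes "x \<in> {0..1}" "y \<in> {0..1}" "x' \<in> {0..1}" "y' \<in> {0..1}" "x \<le> x'" "y \<le> y'"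
  shows "U x y \<le> U x' y'"
proof -
  have "mono_on {0..1} (\<lambda>x. U x y)" "mono_on {0..1} (\<lambda>y. U x' y)"
    using U assms unfolding uninorm_with_def by blast+
  then have "U x y \<le> U x' y" "U x' y \<le> U x' y'"
    using assms unfolding mono_on_def by blast+
  then show ?thesis by simp
qed

lemma continuous_on_tnorm_iff:
  "continuous_on ({0..1} \<times> {0..1}) (\<lambda>(x, y). underlying_tnorm e U x y) \<longleftrightarrow>
   continuous_on ({0..e} \<times> {0..e}) (\<lambda>(x, y). U x y)"
  (is "?T \<longleftrightarrow> ?U")
proof
  assume T: ?T
  have "continuous_on ({0..e} \<times> {0..e})
      ((\<lambda>(x, y). underlying_tnorm e U x y) \<circ> (\<lambda>(x, y). (x / e, y / e)))"
    using uninorm_neutral_bounds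
    by (intro continuous_on_compose continuous_on_subset[OF T])
      (auto intro!: continuous_intros simp: case_prod_unfold divide_le_eq_1)
  then have "continuous_on ({0..e} \<times> {0..e})
      (\<lambda>z. e * ((\<lambda>(x, y). underlying_tnorm e U x y) \<circ> (\<lambda>(x, y). (x / e, y / e))) z)"
    by (intro continuous_on_mult continuous_on_const)
  then show ?U
    using uninorm_neutral_bounds by (simp add: o_def case_prod_unfold underlying_tnorm_def)
next
  assume C: ?U
  have "continuous_on ({0..1} \<times> {0..1}) ((\<lambda>(x, y). U x y) \<circ> (\<lambda>(x, y). (e * x, e * y)))"
    using uninorm_neutral_bounds
    by (intro continuous_on_compose continuous_on_subset[OF C])
      (auto intro!: continuous_intros simp: case_prod_unfold mult_left_le)
  then have "continuous_on ({0..1} \<times> {0..1})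
      (\<lambda>z. (1 / e) * ((\<lambda>(x, y). U x y) \<circ> (\<lambda>(x, y). (e * x, e * y))) z)"
    by (intro continuous_on_mult continuous_on_const)
  then show ?T
    by (simp add: o_def case_prod_unfold underlying_tnorm_def)
qed

end

section \<open>Duality\<close>

definition dual_op :: "(real \<Rightarrow> real \<Rightarrow> real) \<Rightarrow> real \<Rightarrow> real \<Rightarrow> real" where
  "dual_op U x y = 1 - U (1 - x) (1 - y)"

lemma uninorm_with_dual:
  assumes "uninorm_with e U"
  shows "uninorm_with (1 - e) (dual_op U)"
  using assms unfolding uninorm_with_def dual_op_def mono_on_def by auto

lemma tconorm_eq_dual_tnorm:
  assumes "e < 1"
  shows "underlying_tconorm e U x y = 1 - underlying_tnorm (1 - e) (dual_op U) (1 - x) (1 - y)"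
proof -
  have "1 - (1 - e) * (1 - t) = e + (1 - e) * t" for t
    by (simp add: algebra_simps)
  then show ?thesis
    using assms unfolding underlying_tconorm_def underlying_tnorm_def dual_op_def
    by (simp add: field_simps)
qed

lemma continuous_on_reflect:
  fixes g :: "real \<Rightarrow> real \<Rightarrow> real"
  assumes "continuous_on ({0..1} \<times> {0..1}) (\<lambda>(x, y). g x y)"
  shows "continuous_on ({0..1} \<times> {0..1}) (\<lambda>(x, y). 1 - g (1 - x) (1 - y))"
proof -
  have "continuous_on ({0..1} \<times> {0..1}) ((\<lambda>(x, y). g x y) \<circ> (\<lambda>(x, y). (1 - x, 1 - y)))"
    by (intro continuous_on_compose continuous_on_subset[OF assms])
      (auto intro!: continuous_intros simp: case_prod_unfold)
  then have "continuous_on ({0..1} \<times> {0..1})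
      (\<lambda>z. 1 - ((\<lambda>(x, y). g x y) \<circ> (\<lambda>(x, y). (1 - x, 1 - y))) z)"
    by (intro continuous_on_diff continuous_on_const)
  then show ?thesis by (simp add: o_def case_prod_unfold)
qed

lemma continuous_on_tconorm_iff:
  assumes "e < 1"
  shows "continuous_on ({0..1} \<times> {0..1}) (\<lambda>(x, y). underlying_tconorm e U x y) \<longleftrightarrow>
    continuous_on ({0..1} \<times> {0..1}) (\<lambda>(x, y). underlying_tnorm (1 - e) (dual_op U) x y)"
  using continuous_on_reflect[of "underlying_tconorm e U"]
    continuous_on_reflect[of "underlying_tnorm (1 - e) (dual_op U)"]
  by (auto simp: tconorm_eq_dual_tnorm[OF assms])

lemma left_continuous_dual:
  assumes "right_continuous_at U x y"
  shows "left_continuous_at (dual_op U) (1 - x) (1 - y)"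
  unfolding left_continuous_at_def
proof (intro allI impI)
  fix \<epsilon> :: real assume "\<epsilon> > 0"
  then obtain \<delta> where \<delta>: "\<delta> > 0" "\<And>s t. s \<in> {0..1} \<Longrightarrow> t \<in> {0..1} \<Longrightarrow>
      s \<in> {x..x + \<delta>} \<Longrightarrow> t \<in> {y..y + \<delta>} \<Longrightarrow> \<bar>U s t - U x y\<bar> < \<epsilon>"
    using assms unfolding right_continuous_at_def by meson
  have "\<bar>dual_op U s t - dual_op U (1 - x) (1 - y)\<bar> < \<epsilon>"
    if "s \<in> {0..1}" "t \<in> {0..1}" "s \<in> {1 - x - \<delta>..1 - x} \<and> t \<in> {1 - y - \<delta>..1 - y}" for s t
    using \<delta>(2)[of "1 - s" "1 - t"] that unfolding dual_op_def by auto
  with \<delta>(1) show "\<exists>\<delta>>0. \<forall>s\<in>{0..1}. \<forall>t\<in>{0..1}.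
      s \<in> {1 - x - \<delta>..1 - x} \<and> t \<in> {1 - y - \<delta>..1 - y} \<longrightarrow>
      \<bar>dual_op U s t - dual_op U (1 - x) (1 - y)\<bar> < \<epsilon>"
    by blast
qed

lemma right_continuous_dual:
  assumes "left_continuous_at U x y"
  shows "right_continuous_at (dual_op U) (1 - x) (1 - y)"
  unfolding right_continuous_at_def
proof (intro allI impI)
  fix \<epsilon> :: real assume "\<epsilon> > 0"
  then obtain \<delta> where \<delta>: "\<delta> > 0" "\<And>s t. s \<in> {0..1} \<Longrightarrow> t \<in> {0..1} \<Longrightarrow>
      s \<in> {x - \<delta>..x} \<Longrightarrow> t \<in> {y - \<delta>..y} \<Longrightarrow> \<bar>U s t - U x y\<bar> < \<epsilon>"
    using assms unfolding left_continuous_at_def by meson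
  have "\<bar>dual_op U s t - dual_op U (1 - x) (1 - y)\<bar> < \<epsilon>"
    if "s \<in> {0..1}" "t \<in> {0..1}" "s \<in> {1 - x..1 - x + \<delta>} \<and> t \<in> {1 - y..1 - y + \<delta>}" for s t
    using \<delta>(2)[of "1 - s" "1 - t"] that unfolding dual_op_def by auto
  with \<delta>(1) show "\<exists>\<delta>>0. \<forall>s\<in>{0..1}. \<forall>t\<in>{0..1}.
      s \<in> {1 - x..1 - x + \<delta>} \<and> t \<in> {1 - y..1 - y + \<delta>} \<longrightarrow>
      \<bar>dual_op U s t - dual_op U (1 - x) (1 - y)\<bar> < \<epsilon>"
    by blast
qed

lemma dual_op_involutive [simp]: "dual_op (dual_op U) = U"
  by (simp add: dual_op_def fun_eq_iff)

text \<open>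
  The graph of \<open>r\<close> is the curve \<open>R\<close> of the class \<open>\<U>\<R>\<close>. As a predicate on \<open>e\<close>, \<open>U\<close> and \<open>r\<close> its
  properties can be transported to the dual uninorm, whose curve is \<open>R\<close> reflected in the centre
  of the unit square.
\<close>

definition discontinuity_curve :: "real \<Rightarrow> (real \<Rightarrow> real \<Rightarrow> real) \<Rightarrow> (real \<Rightarrow> real set) \<Rightarrow> bool" where
  "discontinuity_curve e U r \<longleftrightarrow>
     sv_symmetric r \<and> sv_nonincreasing r \<and>
     (\<forall>z \<in> {0..1} \<times> {0..1} - sv_graph r. continuous (at z within {0..1} \<times> {0..1}) (\<lambda>(x, y). U x y)) \<and>
     (\<forall>x\<in>{0..1}. \<forall>y\<in>{0..1}. U x y = e \<longrightarrow> (x, y) \<in> sv_graph r)"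

lemma discontinuity_curve_dual:
  assumes "discontinuity_curve e U r"
  shows "discontinuity_curve (1 - e) (dual_op U) (\<lambda>x. (-) 1 ` r (1 - x))"
proof -
  define r' where "r' = (\<lambda>x. (-) 1 ` r (1 - x))"
  have mem: "y \<in> r' x \<longleftrightarrow> 1 - y \<in> r (1 - x)" for x y
    unfolding r'_def by (force simp: image_iff)
  have graph: "(x, y) \<in> sv_graph r' \<longleftrightarrow> (1 - x, 1 - y) \<in> sv_graph r" for x y
    unfolding sv_graph_def by (auto simp: mem)
  have "sv_symmetric r'"
    using assms unfolding discontinuity_curve_def sv_symmetric_def mem by simp
  moreover have "sv_nonincreasing r'"
    unfolding sv_nonincreasing_def mem
  proof (intro ballI impI)
    fix x1 x2 y1 y2 :: real
    assume "x1 \<in> {0..1}" "x2 \<in> {0..1}" "x1 < x2" "y1 \<in> r' x1" "y2 \<in> r' x2"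
    moreover have "sv_nonincreasing r" using assms unfolding discontinuity_curve_def by blast
    ultimately have "1 - y2 \<ge> 1 - y1"
      unfolding sv_nonincreasing_def mem
      by (metis (no_types) atLeastAtMost_iff diff_ge_0_iff_ge diff_left_mono diff_strict_left_mono
          diff_zero)
    then show "y2 \<le> y1" by simp
  qed
  moreover have "continuous (at z within {0..1} \<times> {0..1}) (\<lambda>(x, y). dual_op U x y)"
    if "z \<in> {0..1} \<times> {0..1} - sv_graph r'" for z
  proof -
    let ?Q = "{0..1::real} \<times> {0..1::real}" and ?h = "\<lambda>p::real \<times> real. (1 - fst p, 1 - snd p)"
    have image: "?h ` ?Q \<subseteq> ?Q" by auto
    have "?h z \<in> ?Q - sv_graph r"
      using that graph by (cases z) auto
    then have "continuous (at (?h z) within ?Q) (\<lambda>(x, y). U x y)"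
      using assms unfolding discontinuity_curve_def by blast
    then have "continuous (at (?h z) within ?h ` ?Q) (\<lambda>(x, y). U x y)"
      using image continuous_within_subset by blast
    moreover have "continuous (at z within ?Q) ?h"
      by (intro continuous_intros)
    ultimately have "continuous (at z within ?Q) ((\<lambda>(x, y). U x y) \<circ> ?h)"
      by (intro continuous_within_compose)
    then have "continuous (at z within ?Q) (\<lambda>p. 1 - ((\<lambda>(x, y). U x y) \<circ> ?h) p)"
      by (intro continuous_diff continuous_const)
    then show ?thesis
      by (simp add: o_def case_prod_unfold dual_op_def)
  qed
  moreover have "(x, y) \<in> sv_graph r'"
    if "x \<in> {0..1}" "y \<in> {0..1}" "dual_op U x y = 1 - e" for x y
    using assms that unfolding discontinuity_curve_def graph dual_op_def by auto
  ultimately have "discontinuity_curve (1 - e) (dual_op U) r'"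
    unfolding discontinuity_curve_def by blast
  then show ?thesis unfolding r'_def .
qed

section \<open>Left-continuity below the neutral element\<close>

text \<open>
  Continuity of the t-norm makes \<open>U u\<close> attain on \<open>[0,e]\<close> every value in \<open>[0,u]\<close>, and associativity
  moves the extra argument \<open>s \<le> e\<close> into the first factor, where it decreases \<open>x\<close>.
\<close>

lemma smaller_value_attained:
  assumes U: "uninorm_with e U"
    and cont: "continuous_on ({0..e} \<times> {0..e}) (\<lambda>(x, y). U x y)"
    and "x \<in> {0..1}" "y \<in> {0..1}" "U x y \<le> e" "0 \<le> c" "c < U x y"
  obtains q where "q \<in> {0..1}" "q < x" "U q y = c"
proof -
  note [simp] = uninorm_neutral_bounds[OF U, THEN less_imp_le]
  define u where "u = U x y"
  have u: "u \<in> {0..e}" "u \<in> {0..1}"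
    using uninorm_range[OF U] assms unfolding u_def by auto
  have "continuous_on {0..e} ((\<lambda>(x, y). U x y) \<circ> (\<lambda>s. (u, s)))"
    using u by (intro continuous_on_compose continuous_on_subset[OF cont])
      (auto intro!: continuous_intros)
  then have "continuous_on {0..e} (U u)" by (simp add: o_def)
  moreover have "U u 0 \<le> c"
    using uninorm_mono[OF U, of u 0 e 0] uninorm_neutral_left[OF U, of 0] u \<open>0 \<le> c\<close> by auto
  moreover have "c \<le> U u e"
    using uninorm_neutral_right[OF U, of u] u assms unfolding u_def by simp
  ultimately obtain s where s: "0 \<le> s" "s \<le> e" "U u s = c"
    using IVT'[of "U u" 0 c e] by auto
  then have s1: "s \<in> {0..1}" using uninorm_neutral_bounds[OF U] by auto
  define q where "q = U x s"
  have q1: "q \<in> {0..1}" unfolding q_def using uninorm_range[OF U] assms s1 by blast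
  have "q \<le> U x e"
    unfolding q_def using uninorm_mono[OF U, of x s x e] s s1 assms by auto
  then have "q \<le> x" using uninorm_neutral_right[OF U] assms by simp
  moreover have "U q y = c"
  proof -
    have "U q y = U x (U s y)" unfolding q_def using uninorm_assoc[OF U] assms s1 by blast
    also have "\<dots> = U x (U y s)" using uninorm_commute[OF U] assms s1 by simp
    also have "\<dots> = U u s" unfolding u_def using uninorm_assoc[OF U] assms s1 by simp
    finally show ?thesis using s by simp
  qed
  moreover from this have "q \<noteq> x" using assms by auto
  ultimately show ?thesis using that[of q] q1 by auto
qed

text \<open>
  Attaining a smaller value in each coordinate in turn produces a corner \<open>(q, p)\<close> strictly below
  \<open>(x, y)\<close> at which \<open>U\<close> is within \<open>\<epsilon>\<close> of \<open>U x y\<close>; monotonicity does the rest. There is room for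
  such values as long as \<open>\<epsilon> \<le> U x y\<close>; for larger \<open>\<epsilon>\<close> the bound \<open>U \<ge> 0\<close> is enough.
\<close>

lemma left_continuous_below_neutral:
  assumes U: "uninorm_with e U"
    and cont: "continuous_on ({0..e} \<times> {0..e}) (\<lambda>(x, y). U x y)"
    and x: "x \<in> {0..1}" and y: "y \<in> {0..1}" and le: "U x y \<le> e"
  shows "left_continuous_at U x y"
  unfolding left_continuous_at_def
proof (intro allI impI)
  fix \<epsilon> :: real assume "\<epsilon> > 0"
  have upper: "U s t \<le> U x y" if "s \<in> {0..1}" "t \<in> {0..1}" "s \<le> x" "t \<le> y" for s t
    using uninorm_mono[OF U] that x y by blast
  have "\<exists>\<delta>>0. \<forall>s\<in>{0..1}. \<forall>t\<in>{0..1}. x - \<delta> \<le> s \<and> y - \<delta> \<le> t \<longrightarrow> U x y - \<epsilon> < U s t"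
  proof (cases "U x y < \<epsilon>")
    case True
    have "U x y - \<epsilon> < U s t" if "s \<in> {0..1}" "t \<in> {0..1}" for s t
      using uninorm_range[OF U that] True by auto
    then show ?thesis by (intro exI[of _ 1]) auto
  next
    case False
    then obtain q where q: "q \<in> {0..1}" "q < x" "U q y = U x y - \<epsilon> / 3"
      using smaller_value_attained[OF U cont x y le, of "U x y - \<epsilon> / 3"] \<open>\<epsilon> > 0\<close> by auto
    have comm: "U y q = U q y" using uninorm_commute[OF U] q y by blast
    obtain p where p: "p \<in> {0..1}" "p < y" "U p q = U x y - 2 * \<epsilon> / 3"
      using smaller_value_attained[OF U cont y q(1), of "U x y - 2 * \<epsilon> / 3"] comm q le
        False \<open>\<epsilon> > 0\<close> by auto
    have "U x y - \<epsilon> < U s t" if "s \<in> {0..1}" "t \<in> {0..1}" "q \<le> s" "p \<le> t" for s t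
    proof -
      have "U q p \<le> U s t" using uninorm_mono[OF U] that p q by blast
      moreover have "U q p = U p q" using uninorm_commute[OF U] p q by blast
      ultimately show ?thesis using p \<open>\<epsilon> > 0\<close> by simp
    qed
    then show ?thesis
      using p q by (intro exI[of _ "min (x - q) (y - p)"]) auto
  qed
  then obtain \<delta> where \<delta>: "\<delta> > 0" "\<And>s t. s \<in> {0..1} \<Longrightarrow> t \<in> {0..1} \<Longrightarrow>
      x - \<delta> \<le> s \<Longrightarrow> y - \<delta> \<le> t \<Longrightarrow> U x y - \<epsilon> < U s t"
    by blast
  have "\<bar>U s t - U x y\<bar> < \<epsilon>"
    if "s \<in> {0..1}" "t \<in> {0..1}" "s \<in> {x - \<delta>..x} \<and> t \<in> {y - \<delta>..y}" for s t
    using \<delta>(2)[of s t] upper[of s t] that \<open>\<epsilon> > 0\<close> by auto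
  with \<delta>(1) show "\<exists>\<delta>>0. \<forall>s\<in>{0..1}. \<forall>t\<in>{0..1}. s \<in> {x - \<delta>..x} \<and> t \<in> {y - \<delta>..y} \<longrightarrow>
      \<bar>U s t - U x y\<bar> < \<epsilon>"
    by blast
qed

section \<open>Continuity of the t-norm from one-sided continuity\<close>

lemma discontinuity_curve_continuous:
  assumes "discontinuity_curve e U r" "x \<in> {0..1}" "y \<in> {0..1}" "(x, y) \<notin> sv_graph r"
  shows "continuous (at (x, y) within {0..1} \<times> {0..1}) (\<lambda>(x, y). U x y)"
  using assms unfolding discontinuity_curve_def by blast

lemma discontinuity_curve_noninc:
  assumes "discontinuity_curve e U r" "(x1, y1) \<in> sv_graph r" "(x2, y2) \<in> sv_graph r" "x1 < x2"
  shows "y2 \<le> y1"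
  using assms unfolding discontinuity_curve_def sv_graph_def sv_nonincreasing_def by blast

lemma discontinuity_curve_sym:
  assumes "discontinuity_curve e U r" "(x, y) \<in> sv_graph r"
  shows "(y, x) \<in> sv_graph r"
  using assms unfolding discontinuity_curve_def sv_graph_def sv_symmetric_def by blast

lemma left_continuous_if_continuous:
  assumes "continuous (at (x, y) within {0..1} \<times> {0..1}) (\<lambda>(x, y). U x y)"
  shows "left_continuous_at U x y"
  unfolding left_continuous_at_def
proof (intro allI impI)
  fix \<epsilon> :: real assume "\<epsilon> > 0"
  then obtain d where d: "d > 0" "\<And>s t. s \<in> {0..1} \<Longrightarrow> t \<in> {0..1} \<Longrightarrow>
      dist (s, t) (x, y) < d \<Longrightarrow> dist (U s t) (U x y) < \<epsilon>"
    using assms unfolding continuous_within_eps_delta by (force simp: Ball_def)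
  have "\<bar>U s t - U x y\<bar> < \<epsilon>"
    if "s \<in> {0..1}" "t \<in> {0..1}" "s \<in> {x - d / 3..x} \<and> t \<in> {y - d / 3..y}" for s t
  proof -
    have "dist (s, t) (x, y) \<le> \<bar>s - x\<bar> + \<bar>t - y\<bar>"
      unfolding dist_Pair_Pair dist_real_def
      using sqrt_sum_squares_le_sum_abs[of "\<bar>s - x\<bar>" "\<bar>t - y\<bar>"] by simp
    also have "\<dots> < d" using that d by auto
    finally show ?thesis using d(2)[of s t] that by (auto simp: dist_real_def)
  qed
  with d(1) show "\<exists>\<delta>>0. \<forall>s\<in>{0..1}. \<forall>t\<in>{0..1}. s \<in> {x - \<delta>..x} \<and> t \<in> {y - \<delta>..y} \<longrightarrow>
      \<bar>U s t - U x y\<bar> < \<epsilon>"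
    by (intro exI[of _ "d / 3"]) auto
qed

text \<open>
  A horizontal segment that starts at \<open>(e, y)\<close>, where \<open>U\<close> equals \<open>y > e\<close>, and does not meet the
  curve cannot lead down to the level \<open>e\<close>, since \<open>U\<close> takes the value \<open>e\<close> only on the curve.
\<close>

lemma above_neutral_off_curve:
  assumes U: "uninorm_with e U" and curve: "discontinuity_curve e U r"
    and x: "0 \<le> x" "x \<le> e" and y: "e < y" "y \<le> 1"
    and off: "\<And>p. p \<in> {x..e} \<Longrightarrow> (p, y) \<notin> sv_graph r"
  shows "e < U x y"
proof (rule ccontr)
  assume "\<not> e < U x y"
  note bounds = uninorm_neutral_bounds[OF U]
  have "continuous_on {x..e} (\<lambda>p. U p y)"
    unfolding continuous_on_eq_continuous_within
  proof
    fix p assume p: "p \<in> {x..e}"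
    have "continuous (at (p, y) within {0..1} \<times> {0..1}) (\<lambda>(x, y). U x y)"
      by (rule discontinuity_curve_continuous[OF curve]) (use p x y off bounds in auto)
    then have "continuous (at (p, y) within (\<lambda>q. (q, y)) ` {x..e}) (\<lambda>(x, y). U x y)"
      by (rule continuous_within_subset) (use x y bounds in auto)
    then have "continuous (at p within {x..e}) ((\<lambda>(x, y). U x y) \<circ> (\<lambda>q. (q, y)))"
      by (intro continuous_within_compose continuous_intros)
    then show "continuous (at p within {x..e}) (\<lambda>p. U p y)" by (simp add: o_def)
  qed
  moreover have "e \<le> U e y" using uninorm_neutral_left[OF U, of y] y bounds by simp
  ultimately obtain p where "x \<le> p" "p \<le> e" "U p y = e"
    using IVT'[of "\<lambda>p. U p y" x e e] \<open>\<not> e < U x y\<close> x by auto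
  moreover from this have "(p, y) \<in> sv_graph r"
    using curve x y bounds unfolding discontinuity_curve_def by auto
  ultimately show False using off by auto
qed

text \<open>
  If \<open>(x, e)\<close> is on the curve, then \<open>U > e\<close> at points arbitrarily close to it on the upper right,
  while \<open>U x e = x < e\<close>. So right-continuity fails there and left-continuity is the only option.
\<close>

lemma left_continuous_at_neutral:
  assumes U: "uninorm_with e U" and curve: "discontinuity_curve e U r"
    and x: "0 \<le> x" "x < e"
    and one_sided: "left_continuous_at U x e \<or> right_continuous_at U x e"
  shows "left_continuous_at U x e"
proof (cases "(x, e) \<in> sv_graph r")
  case False
  with discontinuity_curve_continuous[OF curve, of x e] show ?thesis
    using x uninorm_neutral_bounds[OF U] by (auto intro: left_continuous_if_continuous)
next
  case True
  note bounds = uninorm_neutral_bounds[OF U]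
  have "\<not> right_continuous_at U x e"
  proof
    assume "right_continuous_at U x e"
    then obtain \<delta> where \<delta>: "\<delta> > 0" "\<And>s t. s \<in> {0..1} \<Longrightarrow> t \<in> {0..1} \<Longrightarrow>
        s \<in> {x..x + \<delta>} \<Longrightarrow> t \<in> {e..e + \<delta>} \<Longrightarrow> \<bar>U s t - U x e\<bar> < e - x"
      using x unfolding right_continuous_at_def by (metis diff_gt_0_iff_gt)
    define s t where "s = min e (x + \<delta>)" and "t = min 1 (e + \<delta>)"
    have s: "x < s" "s \<le> e" "s \<le> x + \<delta>" and t: "e < t" "t \<le> 1" "t \<le> e + \<delta>"
      using x \<delta> bounds unfolding s_def t_def by auto
    have "e < U s t"
    proof (rule above_neutral_off_curve[OF U curve])
      fix p assume p: "p \<in> {s..e}"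
      show "(p, t) \<notin> sv_graph r"
      proof
        \<comment> \<open>By symmetry \<open>(e, x)\<close> and \<open>(t, p)\<close> would both lie on the decreasing curve.\<close>
        assume "(p, t) \<in> sv_graph r"
        then have "p \<le> x"
          using discontinuity_curve_noninc[OF curve, of e x t p] True t
          by (auto intro: discontinuity_curve_sym[OF curve])
        then show False using p s by auto
      qed
    qed (use s t x in auto)
    moreover have "\<bar>U s t - U x e\<bar> < e - x"
      using \<delta>(2)[of s t] s t x bounds by auto
    moreover have "U x e = x" using uninorm_neutral_right[OF U] x bounds by simp
    ultimately show False by simp
  qed
  with one_sided show ?thesis by blast
qed

text \<open>
  On the edge of the square \<open>U s t \<le> U s e = s\<close> bounds \<open>U\<close> from above. The bound from below comes
  from left-continuity at a point \<open>(a, e)\<close> slightly to the left of \<open>(x, e)\<close>, or at \<open>(0, e)\<close>; moving there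
  gives \<open>U s t \<ge> U a t\<close> for all \<open>s \<ge> a\<close>, on both sides of \<open>x\<close>, and reduces the corner \<open>x = e\<close> to
  the points \<open>(a, e)\<close> with \<open>a < e\<close>.
\<close>

lemma continuous_within_neutral_edge:
  assumes U: "uninorm_with e U"
    and left: "\<And>x. 0 \<le> x \<Longrightarrow> x < e \<Longrightarrow> left_continuous_at U x e"
    and x: "0 \<le> x" "x \<le> e"
  shows "continuous (at (x, e) within {0..e} \<times> {0..e}) (\<lambda>(x, y). U x y)"
  unfolding continuous_within_eps_delta
proof (intro allI impI)
  fix \<epsilon> :: real assume "\<epsilon> > 0"
  note bounds = uninorm_neutral_bounds[OF U]
  define a where "a = max 0 (x - \<epsilon> / 2)"
  have Uxe: "U x e = x" and Uae: "U a e = a"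
    using uninorm_neutral_right[OF U] x bounds \<open>\<epsilon> > 0\<close> unfolding a_def by auto
  have "0 \<le> a" "a < e" using x bounds \<open>\<epsilon> > 0\<close> unfolding a_def by auto
  with left \<open>\<epsilon> > 0\<close> obtain \<delta> where \<delta>: "\<delta> > 0" "\<And>s t. s \<in> {0..1} \<Longrightarrow> t \<in> {0..1} \<Longrightarrow>
      s \<in> {a - \<delta>..a} \<Longrightarrow> t \<in> {e - \<delta>..e} \<Longrightarrow> \<bar>U s t - U a e\<bar> < \<epsilon> / 2"
    unfolding left_continuous_at_def by (metis half_gt_zero)
  define d where "d = min \<delta> (\<epsilon> / 2)"
  have "d > 0" using \<delta> \<open>\<epsilon> > 0\<close> unfolding d_def by simp
  have "dist (U s t) (U x e) < \<epsilon>"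
    if st: "s \<in> {0..e}" "t \<in> {0..e}" and dist: "dist (s, t) (x, e) < d" for s t
  proof -
    have "\<bar>s - x\<bar> < d" "\<bar>t - e\<bar> < d"
      using dist dist_fst_le[of "(s, t)" "(x, e)"] dist_snd_le[of "(s, t)" "(x, e)"]
      by (auto simp: dist_real_def)
    then have near: "\<bar>s - x\<bar> < \<epsilon> / 2" "e - \<delta> \<le> t" unfolding d_def by auto
    have "x - \<epsilon> / 2 \<le> s" using near by linarith
    then have "a \<le> s" using st unfolding a_def by simp
    then have "U a t \<le> U s t"
      using uninorm_mono[OF U, of a t s t] st bounds \<open>0 \<le> a\<close> by auto
    moreover have "\<bar>U a t - U a e\<bar> < \<epsilon> / 2"
      using \<delta>(2)[of a t] \<delta>(1) st near bounds \<open>0 \<le> a\<close> \<open>a < e\<close> by auto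
    moreover have "U s t \<le> U s e" "U s e = s"
      using uninorm_mono[OF U, of s t s e] uninorm_neutral_right[OF U, of s] st bounds by auto
    moreover have "x - \<epsilon> / 2 \<le> a" unfolding a_def by simp
    ultimately show ?thesis
      using near Uxe Uae \<open>\<epsilon> > 0\<close> unfolding dist_real_def by linarith
  qed
  with \<open>d > 0\<close> show "\<exists>d>0. \<forall>z\<in>{0..e} \<times> {0..e}. dist z (x, e) < d \<longrightarrow>
      dist (case z of (x, y) \<Rightarrow> U x y) (case (x, e) of (x, y) \<Rightarrow> U x y) < \<epsilon>"
    by (intro exI[of _ d]) auto
qed

lemma continuous_lower_square:
  assumes U: "uninorm_with e U" and curve: "discontinuity_curve e U r"
    and one_sided: "\<And>x y. x \<in> {0..1} \<Longrightarrow> y \<in> {0..1} \<Longrightarrow>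
      left_continuous_at U x y \<or> right_continuous_at U x y"
  shows "continuous_on ({0..e} \<times> {0..e}) (\<lambda>(x, y). U x y)"
  unfolding continuous_on_eq_continuous_within
proof
  note bounds = uninorm_neutral_bounds[OF U]
  let ?E = "{0..e} \<times> {0..e}"
  fix z assume "z \<in> ?E"
  then obtain x y where z: "z = (x, y)" and x: "0 \<le> x" "x \<le> e" and y: "0 \<le> y" "y \<le> e" by auto
  have edge: "continuous (at (p, e) within ?E) (\<lambda>(x, y). U x y)" if "0 \<le> p" "p \<le> e" for p
    by (rule continuous_within_neutral_edge[OF U _ that])
      (use left_continuous_at_neutral[OF U curve] one_sided bounds in auto)
  consider "y = e" | "x = e" | "x < e" "y < e" using x y by linarith
  then show "continuous (at z within ?E) (\<lambda>(x, y). U x y)"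
  proof cases
    case 1
    then show ?thesis using edge[of x] x z by simp
  next
    case 2
    let ?swap = "\<lambda>z::real \<times> real. (snd z, fst z)"
    have swap: "?swap ` ?E = ?E" by force
    have "continuous (at (?swap z) within ?swap ` ?E) (\<lambda>(x, y). U x y)"
      unfolding swap using edge[of y] y z 2 by simp
    then have "continuous (at z within ?E) ((\<lambda>(x, y). U x y) \<circ> ?swap)"
      by (intro continuous_within_compose continuous_intros)
    then show ?thesis
      by (rule continuous_transform_within[where \<delta> = 1])
        (use \<open>z \<in> ?E\<close> uninorm_commute[OF U] bounds in auto)
  next
    case 3
    \<comment> \<open>The point \<open>(e, e)\<close> keeps the decreasing curve away from the open square below it.\<close>
    have "(e, e) \<in> sv_graph r"
      using curve bounds uninorm_neutral_left[OF U, of e]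
      unfolding discontinuity_curve_def by auto
    then have "(x, y) \<notin> sv_graph r"
      using discontinuity_curve_noninc[OF curve, of x y e e] 3 by auto
    then have "continuous (at z within {0..1} \<times> {0..1}) (\<lambda>(x, y). U x y)"
      unfolding z using x y bounds by (intro discontinuity_curve_continuous[OF curve]) auto
    then show ?thesis
      by (rule continuous_within_subset) (use bounds in auto)
  qed
qed

section \<open>The characterization\<close>

theorem theorem3:
  fixes U :: "real \<Rightarrow> real \<Rightarrow> real"
  assumes "uninorm U" and "U \<in> uninorms_UR"
  shows "U \<in> uninorms_cont \<longleftrightarrow>
    (\<forall>x\<in>{0..1}. \<forall>y\<in>{0..1}. left_continuous_at U x y \<or> right_continuous_at U x y)"
proof -
  from assms(2) obtain e r where U: "uninorm_with e U" and curve: "discontinuity_curve e U r"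
    unfolding uninorms_UR_def discontinuity_curve_def by blast
  note dual = uninorm_with_dual[OF U]
  have "U \<in> uninorms_cont \<longleftrightarrow>
      continuous_on ({0..1} \<times> {0..1}) (\<lambda>(x, y). underlying_tnorm e U x y) \<and>
      continuous_on ({0..1} \<times> {0..1}) (\<lambda>(x, y). underlying_tconorm e U x y)"
    unfolding uninorms_cont_def using U uninorm_with_unique by blast
  also have "\<dots> \<longleftrightarrow> continuous_on ({0..e} \<times> {0..e}) (\<lambda>(x, y). U x y) \<and>
      continuous_on ({0..1 - e} \<times> {0..1 - e}) (\<lambda>(x, y). dual_op U x y)"
    using continuous_on_tconorm_iff[OF uninorm_neutral_bounds(2)[OF U], of U]
      continuous_on_tnorm_iff[OF U] continuous_on_tnorm_iff[OF dual] by simp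
  also have "\<dots> \<longleftrightarrow>
      (\<forall>x\<in>{0..1}. \<forall>y\<in>{0..1}. left_continuous_at U x y \<or> right_continuous_at U x y)"
    (is "?C \<longleftrightarrow> ?LR")
  proof
    assume C: ?C
    show ?LR
    proof (intro ballI)
      fix x y :: real assume xy: "x \<in> {0..1}" "y \<in> {0..1}"
      show "left_continuous_at U x y \<or> right_continuous_at U x y"
      proof (cases "U x y \<le> e")
        case True
        then show ?thesis using left_continuous_below_neutral[OF U] C xy by blast
      next
        case False
        then have "left_continuous_at (dual_op U) (1 - x) (1 - y)"
          using C xy by (intro left_continuous_below_neutral[OF dual]) (auto simp: dual_op_def)
        then show ?thesis using right_continuous_dual by fastforce
      qed
    qed
  next
    assume LR: ?LR
    have "left_continuous_at (dual_op U) x y \<or> right_continuous_at (dual_op U) x y"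
      if "x \<in> {0..1}" "y \<in> {0..1}" for x y
    proof -
      have "left_continuous_at U (1 - x) (1 - y) \<or> right_continuous_at U (1 - x) (1 - y)"
        using LR that by auto
      then show ?thesis
        using left_continuous_dual[of U "1 - x" "1 - y"] right_continuous_dual[of U "1 - x" "1 - y"]
        by auto
    qed
    then show ?C
      using continuous_lower_square[OF U curve] LR
        continuous_lower_square[OF dual discontinuity_curve_dual[OF curve]] by blast
  qed
  finally show ?thesis .
qed

end
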